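(* Let $\alpha\in(0,1]$, $A\in C(\mathbb{R},\mathbb{R}^{n\times n})$, $t_0\in\mathbb{R}$, $x_0\in\mathbb{R}^n$. The general solution of $\mathcal{T}^\alpha x=A(t)x$ associated with the initial data $x(t_0)=x_0$ can be written as $$x(t)=X(t)X^{-1}(t_0)x_0,\qquad t\in\mathbb{R},$$ where $X(t)$ is any fundamental solution of $\mathcal{T}^\alpha x=A(t)x$.
   Context: For $\alpha\in(0,1]$ the $\alpha$-conformable fractional derivative is $\mathcal{T}^\alpha g(t):=\lim_{\varepsilon\to0}\frac{g(t+\varepsilon|t|^{1-\alpha})-g(t)}{\varepsilon}$ (so $\mathcal{T}^\alpha g(t)=|t|^{1-\alpha}g'(t)$ for $t\ne0$), with $\mathcal{T}^\alpha g(0):=\lim_{t\to0}\mathcal{T}^\alpha g(t)$ if this limit exists. Solutions are continuous functions on $\mathbb{R}$ satisfying the equation. A fundamental solution is an $n\times n$ matrix function $X(t)$ whose columns are $n$ linearly independent solutions. *)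

theory Defs
  imports "HOL-Analysis.Analysis"
begin

definition conformable_quotient_limit ::
    "real \<Rightarrow> (real \<Rightarrow> 'a::real_normed_vector) \<Rightarrow> 'a \<Rightarrow> real \<Rightarrow> bool" where
  "conformable_quotient_limit \<alpha> g v t \<longleftrightarrow>
     ((\<lambda>\<epsilon>. (g (t + \<epsilon> * \<bar>t\<bar> powr (1 - \<alpha>)) - g t) /\<^sub>R \<epsilon>) \<longlongrightarrow> v) (at 0)"

text \<open>
  The predicate below says that the \<open>\<alpha>\<close>-conformable derivative of \<open>g\<close> at \<open>t\<close> exists
  and equals \<open>v\<close>.  At \<open>t = 0\<close> it is the limit of the derivatives at nearby points, not
  the difference-quotient limit (which is degenerate there, also because \<open>0 powr 0 = 0\<close>);
  the function \<open>h\<close> gives the derivatives near \<open>0\<close>, so these are required to exist.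
\<close>

definition has_conformable_derivative ::
    "real \<Rightarrow> (real \<Rightarrow> 'a::real_normed_vector) \<Rightarrow> 'a \<Rightarrow> real \<Rightarrow> bool" where
  "has_conformable_derivative \<alpha> g v t \<longleftrightarrow>
     (if t = 0
      then \<exists>h. (\<forall>\<^sub>F s in at 0. conformable_quotient_limit \<alpha> g (h s) s) \<and> (h \<longlongrightarrow> v) (at 0)
      else conformable_quotient_limit \<alpha> g v t)"

definition conformable_solution ::
    "real \<Rightarrow> (real \<Rightarrow> real^'n^'n) \<Rightarrow> (real \<Rightarrow> real^'n) \<Rightarrow> bool" where
  "conformable_solution \<alpha> A x \<longleftrightarrow>
     continuous_on UNIV x \<and> (\<forall>t. has_conformable_derivative \<alpha> x (A t *v x t) t)"

text \<open>
  Linear independence of the columns is that of vector-valued functions on the whole real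
  line, not of their values at a given time; invertibility of \<open>X t\<close> is not assumed.
\<close>

definition fundamental_solution ::
    "real \<Rightarrow> (real \<Rightarrow> real^'n^'n) \<Rightarrow> (real \<Rightarrow> real^'n^'n) \<Rightarrow> bool" where
  "fundamental_solution \<alpha> A X \<longleftrightarrow>
     (\<forall>j. conformable_solution \<alpha> A (\<lambda>t. column j (X t))) \<and>
     (\<forall>c :: 'n \<Rightarrow> real. (\<forall>t. (\<Sum>j\<in>UNIV. c j *\<^sub>R column j (X t)) = 0) \<longrightarrow> (\<forall>j. c j = 0))"

end

theory Submission
  imports Defs
begin

text \<open>
  In the new time \<open>s = sgn t * \<bar>t\<bar> powr \<alpha> / \<alpha>\<close> the equation becomes the ordinary linear system
  \<open>y' = B(s) y\<close> with \<open>B\<close> continuous on the whole line. The condition at \<open>t = 0\<close> carries no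
  information: a continuous function whose derivative off one point agrees with a continuous
  function is differentiable there too. For the linear system, global existence is
  the Peano--Baker series and uniqueness is Gronwall's inequality for \<open>\<parallel>y\<parallel>\<^sup>2\<close>. A vector in the
  kernel of \<open>X t0\<close> gives a solution vanishing at \<open>t0\<close>, hence everywhere, so linear independence
  of the columns as functions forces \<open>X t0\<close> to be invertible.
\<close>

section \<open>Linear differential equations\<close>

lemma bounded_bilinear_matrix_vector_mult:
  "bounded_bilinear ((*v) :: real^'n^'m \<Rightarrow> real^'n \<Rightarrow> real^'m)"
proof -
  have "bilinear ((*v) :: real^'n^'m \<Rightarrow> real^'n \<Rightarrow> real^'m)"
    unfolding bilinear_def
    by (auto intro!: linearI
        simp: matrix_vector_mult_add_rdistrib matrix_vector_right_distrib
          scaleR_matrix_vector_assoc matrix_vector_mult_scaleR)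
  then show ?thesis
    by (simp add: bilinear_conv_bounded_bilinear)
qed

lemmas continuous_on_matrix_vector_mult =
  bounded_bilinear.continuous_on[OF bounded_bilinear_matrix_vector_mult]

text \<open>The image of the compact interval \<open>{-R..R}\<close> under \<open>B\<close> is
  bounded. Since \<open>M\<close> is uniform in \<open>s\<close> and \<open>u\<close>, it serves
  both in the majorant of the series and as a Gronwall constant.\<close>

lemma continuous_matrix_locally_bounded:
  fixes B :: "real \<Rightarrow> real^'n^'m"
  assumes "continuous_on UNIV B"
  obtains M where "0 \<le> M" and "\<And>s u. \<bar>s\<bar> \<le> R \<Longrightarrow> norm (B s *v u) \<le> M * norm u"
proof -
  obtain K where K: "0 \<le> K" "\<And>C u. norm (C *v u) \<le> norm (C :: real^'n^'m) * norm u * K"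
    using bounded_bilinear.nonneg_bounded[OF bounded_bilinear_matrix_vector_mult] by blast
  have "compact (B ` {-R..R})"
    using assms by (intro compact_continuous_image) (auto intro: continuous_on_subset)
  then obtain N where N: "0 < N" "\<forall>C\<in>B ` {-R..R}. norm C \<le> N"
    using compact_imp_bounded bounded_pos by metis
  show thesis
  proof
    show "0 \<le> N * K"
      using K N by simp
    fix s and u :: "real^'n"
    assume "\<bar>s\<bar> \<le> R"
    then have "norm (B s) \<le> N"
      using N(2) by (auto simp: abs_le_iff)
    then have "norm (B s) * norm u * K \<le> N * norm u * K"
      using K by (intro mult_right_mono) auto
    then show "norm (B s *v u) \<le> N * K * norm u"
      using K(2)[of "B s" u] by (simp add: algebra_simps)
  qed
qed

lemma ex_antiderivative:
  fixes f :: "real \<Rightarrow> 'a::euclidean_space"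
  assumes "continuous_on UNIV f"
  shows "\<exists>F. F 0 = 0 \<and> (\<forall>s. (F has_vector_derivative f s) (at s))"
proof -
  have "\<exists>F. \<forall>s::real. - \<infinity> < ereal s \<longrightarrow> ereal s < \<infinity> \<longrightarrow> (F has_vector_derivative f s) (at s)"
    using assms by (intro einterval_antiderivative) (auto simp: continuous_on_eq_continuous_at)
  then obtain F where "\<And>s. (F has_vector_derivative f s) (at s)"
    by auto
  then have "((\<lambda>u. F u - F 0) has_vector_derivative f s) (at s)" for s
    by (auto intro!: derivative_eq_intros)
  then show ?thesis
    by (intro exI[of _ "\<lambda>u. F u - F 0"]) auto
qed

lemma has_vector_derivative_imp_continuous_on:
  assumes "\<And>s. (F has_vector_derivative f s) (at s)"
  shows "continuous_on UNIV F"
  using has_vector_derivative_continuous[OF assms] by (simp add: continuous_on_eq_continuous_at)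

text \<open>Integrating \<open>c * \<bar>s\<bar> ^ k\<close> from 0 brings in the factor
  \<open>1 / Suc k\<close>; iterated, these factors build the factorial in the Peano-Baker bound.
  Negative times reduce to positive ones by reflection.\<close>

lemma norm_antiderivative_le_power:
  fixes F :: "real \<Rightarrow> 'a::real_normed_vector"
  assumes "F 0 = 0" and F: "\<And>s. (F has_vector_derivative f s) (at s)"
    and f: "\<And>s. \<bar>s\<bar> \<le> R \<Longrightarrow> norm (f s) \<le> c * \<bar>s\<bar> ^ k" and s: "\<bar>s\<bar> \<le> R"
  shows "norm (F s) \<le> c * \<bar>s\<bar> ^ Suc k / real (Suc k)"
proof -
  \<comment> \<open>Stated for arbitrary \<open>G\<close> and \<open>g\<close>, because it is
    applied both to \<open>F\<close> and to its reflection.\<close>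
  have pos: "norm (G r) \<le> c * r ^ Suc k / real (Suc k)"
    if "G 0 = 0" "\<And>s. (G has_vector_derivative g s) (at s)"
      "\<And>s. \<bar>s\<bar> \<le> R \<Longrightarrow> norm (g s) \<le> c * \<bar>s\<bar> ^ k" "0 < r" "r \<le> R"
    for G g :: "real \<Rightarrow> 'a" and r
  proof -
    have "norm (G r - G 0) \<le> c * r ^ Suc k / real (Suc k) - c * 0 ^ Suc k / real (Suc k)"
    proof (rule differentiable_bound_general[OF \<open>0 < r\<close>])
      show "continuous_on {0..r} G"
        using has_vector_derivative_imp_continuous_on[OF that(2)]
        by (rule continuous_on_subset) simp
      show "((\<lambda>u. c * u ^ Suc k / real (Suc k)) has_vector_derivative c * u ^ k) (at u)" for u
        unfolding has_real_derivative_iff_has_vector_derivative[symmetric]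
        by (auto intro!: derivative_eq_intros simp del: of_nat_Suc power_Suc)
      show "norm (g u) \<le> c * u ^ k" if "0 < u" "u < r" for u
        using \<open>r \<le> R\<close> that(1,2) \<open>\<And>s. \<bar>s\<bar> \<le> R \<Longrightarrow> norm (g s) \<le> c * \<bar>s\<bar> ^ k\<close>[of u] by auto
    qed (use that in \<open>auto intro!: continuous_intros\<close>)
    then show ?thesis
      using that by simp
  qed
  have "(uminus has_vector_derivative - 1) (at u)" for u :: real
    by (auto intro!: derivative_eq_intros)
  from vector_diff_chain_at[OF this F]
  have neg: "((\<lambda>u. F (- u)) has_vector_derivative - f (- u)) (at u)" for u
    by (simp add: o_def)
  consider "s = 0" | "0 < s" | "s < 0"
    by linarith
  then show ?thesis
  proof cases
    case 2
    then show ?thesis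
      using pos[of F f s] assms by auto
  next
    case 3
    have "norm (- f (- u)) \<le> c * \<bar>u\<bar> ^ k" if "\<bar>u\<bar> \<le> R" for u
      using f[of "- u"] that by simp
    from pos[OF _ neg this, of "- s"] show ?thesis
      using 3 s \<open>F 0 = 0\<close> by simp
  qed (use assms in auto)
qed

text \<open>The solution is the Peano--Baker series, the sum of the Picard increments.\<close>

lemma linear_ode_existence:
  fixes B :: "real \<Rightarrow> real^'n^'n"
  assumes B: "continuous_on UNIV B"
  shows "\<exists>y. y 0 = v \<and> (\<forall>s. (y has_vector_derivative B s *v y s) (at s))"
proof -
  \<comment> \<open>Picard's integral operator, encoded as a chosen antiderivative vanishing at 0.
    Its defining property is available for continuous \<open>f\<close>, so continuity of the
    iterates has to come first.\<close>
  define I where "I f = (SOME F. F 0 = 0 \<and> (\<forall>s. (F has_vector_derivative B s *v f s) (at s)))"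
    for f :: "real \<Rightarrow> real^'n"
  have I: "I f 0 = 0 \<and> (\<forall>s. (I f has_vector_derivative B s *v f s) (at s))"
    if "continuous_on UNIV f" for f
    unfolding I_def
    by (rule someI_ex[OF ex_antiderivative[OF continuous_on_matrix_vector_mult[OF B that]]])
  define y where "y k = (I ^^ k) (\<lambda>_. v)" for k
  have y_0: "y 0 = (\<lambda>_. v)" and y_Suc: "y (Suc k) = I (y k)" for k
    by (simp_all add: y_def)
  have y_cont: "continuous_on UNIV (y k)" for k
  proof (induction k)
    case (Suc k)
    show ?case
      unfolding y_Suc by (rule has_vector_derivative_imp_continuous_on) (use I[OF Suc] in blast)
  qed (simp add: y_0)
  note y_deriv = I[OF y_cont, folded y_Suc]
  \<comment> \<open>The derivatives of the terms. The index shift, with 0 for the constant term,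
    turns the differentiated series into \<open>B s\<close> applied to the original one.\<close>
  define y' where "y' k s = (case k of 0 \<Rightarrow> 0 | Suc j \<Rightarrow> B s *v y j s)" for k s
  have y': "(y k has_vector_derivative y' k s) (at s)" for k s
    using y_deriv by (cases k) (auto simp: y'_def y_0)
  define Y where "Y s = (\<Sum>k. y k s)" for s
  \<comment> \<open>The bound on \<open>B\<close> depends on \<open>R\<close>, so the series is
    differentiated on one bounded interval at a time; \<open>R\<close> is chosen to suit
    \<open>s\<close> at the end.\<close>
  have deriv: "(Y has_vector_derivative B s *v Y s) (at s)" if s: "\<bar>s\<bar> < R" for s R
  proof -
    define S where "S = {-R<..<R}"
    obtain M where M: "0 \<le> M" "\<And>s u. \<bar>s\<bar> \<le> R \<Longrightarrow> norm (B s *v u) \<le> M * norm u"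
      using continuous_matrix_locally_bounded[OF B] by blast
    have y_bound: "norm (y k s) \<le> norm v * M ^ k / fact k * \<bar>s\<bar> ^ k" if "\<bar>s\<bar> \<le> R" for k s
      using that
    proof (induction k arbitrary: s)
      case (Suc k)
      have "norm (B r *v y k r) \<le> M * (norm v * M ^ k / fact k) * \<bar>r\<bar> ^ k" if "\<bar>r\<bar> \<le> R" for r
        using order_trans[OF M(2)[OF that] mult_left_mono[OF Suc.IH[OF that] M(1)]]
        by (simp add: algebra_simps)
      from norm_antiderivative_le_power[OF _ _ this Suc.prems] y_deriv[of k]
      show ?case
        by (simp add: field_simps)
    qed (simp add: y_0)
    \<comment> \<open>The preceding bound in its worst case \<open>\<bar>s\<bar> = R\<close>: the
      terms of the series of \<open>norm v * exp (M * R)\<close>.\<close>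
    define b where "b k = norm v * M ^ k / fact k * R ^ k" for k
    have b: "norm (y k s) \<le> b k" if "\<bar>s\<bar> \<le> R" for k s
    proof -
      have "norm v * M ^ k / fact k * \<bar>s\<bar> ^ k \<le> b k"
        unfolding b_def using that M by (intro mult_left_mono power_mono) auto
      then show ?thesis
        using y_bound[OF that, of k] by linarith
    qed
    have "summable (\<lambda>k. norm v * (inverse (fact k) * (M * R) ^ k))"
      by (intro summable_mult summable_exp)
    then have "summable b"
      by (simp add: b_def[abs_def] field_simps power_mult_distrib)
    define b' where "b' k = (case k of 0 \<Rightarrow> 0 | Suc j \<Rightarrow> M * b j)" for k
    have "summable b'"
      by (subst summable_Suc_iff[symmetric]) (simp add: b'_def \<open>summable b\<close> summable_mult)
    have b': "norm (y' k s) \<le> b' k" if "\<bar>s\<bar> \<le> R" for k s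
      using order_trans[OF M(2)[OF that] mult_left_mono[OF b[OF that] M(1)]]
      by (cases k) (auto simp: y'_def b'_def)
    have y_summable: "summable (\<lambda>k. y k s)" if "\<bar>s\<bar> \<le> R" for s
      by (rule summable_comparison_test'[OF \<open>summable b\<close>]) (rule b[OF that])
    have y'_sums: "(\<lambda>k. y' k s) sums (B s *v Y s)" if "\<bar>s\<bar> \<le> R" for s
    proof -
      have "(\<lambda>k. B s *v y k s) sums (B s *v Y s)"
        unfolding Y_def
        by (intro bounded_linear.sums[OF matrix_vector_mul_bounded_linear] summable_sums
            y_summable that)
      then have "(\<lambda>k. y' (Suc k) s) sums (B s *v Y s)"
        by (simp add: y'_def)
      from sums_Suc[OF this] show ?thesis
        by (simp add: y'_def)
    qed
    have "uniform_limit S (\<lambda>n x. \<Sum>i<n. y' i x) (\<lambda>x. \<Sum>i. y' i x) sequentially"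
      using b' \<open>summable b'\<close> by (intro Weierstrass_m_test) (auto simp: S_def)
    then have lim: "uniform_limit S (\<lambda>n x. \<Sum>i<n. y' i x) (\<lambda>x. B x *v Y x) sequentially"
      by (rule uniform_limit_cong[THEN iffD1, rotated -1])
        (use y'_sums in \<open>auto simp: S_def sums_iff\<close>)
    have "s \<in> S"
      using s by (auto simp: S_def)
    \<comment> \<open>Termwise differentiation on the convex set \<open>S\<close>, from uniform
      convergence of the derivatives and convergence of the series at the single point
      \<open>s\<close>. The sum \<open>g\<close> obtained agrees with \<open>Y\<close> on
      \<open>S\<close>.\<close>
    have "\<exists>g. \<forall>x\<in>S. (\<lambda>n. y n x) sums g x \<and>
        (g has_derivative (\<lambda>h. h *\<^sub>R (B x *v Y x))) (at x within S)"
    proof (rule has_derivative_series[where f' = "\<lambda>k x h. h *\<^sub>R y' k x"])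
      show "(y k has_derivative (\<lambda>h. h *\<^sub>R y' k x)) (at x within S)" for k x
        using y'[of k x] by (simp add: has_vector_derivative_def has_derivative_at_withinI)
      show "\<forall>\<^sub>F n in sequentially. \<forall>x\<in>S. \<forall>h.
          norm ((\<Sum>i<n. h *\<^sub>R y' i x) - h *\<^sub>R (B x *v Y x)) \<le> e * norm h" if "0 < e" for e
        using uniform_limitD[OF lim that]
      proof eventually_elim
        case (elim n)
        have "norm ((\<Sum>i<n. h *\<^sub>R y' i x) - h *\<^sub>R (B x *v Y x)) \<le> e * norm h"
          if "x \<in> S" for x h
        proof -
          have "norm ((\<Sum>i<n. y' i x) - B x *v Y x) \<le> e"
            using elim that by (force simp: dist_norm)
          then have "norm (h *\<^sub>R ((\<Sum>i<n. y' i x) - B x *v Y x)) \<le> e * norm h"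
            using mult_left_mono[of _ e "\<bar>h\<bar>"] by (simp add: mult.commute[of e])
          then show ?thesis
            by (simp only: scaleR_diff_right scaleR_sum_right)
        qed
        then show ?case
          by blast
      qed
      show "(\<lambda>n. y n s) sums Y s"
        unfolding Y_def using y_summable s by (intro summable_sums) auto
    qed (use \<open>s \<in> S\<close> in \<open>auto simp: S_def\<close>)
    then obtain g where g: "\<And>x. x \<in> S \<Longrightarrow> (\<lambda>n. y n x) sums g x"
      "(g has_derivative (\<lambda>h. h *\<^sub>R (B s *v Y s))) (at s within S)"
      using \<open>s \<in> S\<close> by blast
    have "(g has_vector_derivative B s *v Y s) (at s)"
      using g(2) at_within_open[OF \<open>s \<in> S\<close>]
      by (simp add: has_vector_derivative_def S_def)
    then show ?thesis
      by (rule has_vector_derivative_transform_within_open[where S = S])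
        (use g(1) \<open>s \<in> S\<close> in \<open>auto simp: S_def Y_def sums_iff\<close>)
  qed
  \<comment> \<open>All increments after the constant term are antiderivatives vanishing at 0, so
    only \<open>v\<close> is left there.\<close>
  have "y k 0 = 0" if "k \<noteq> 0" for k
    using that y_deriv by (cases k) auto
  then have "Y 0 = v"
    unfolding Y_def by (subst suminf_finite[of "{0}"]) (auto simp: y_0)
  moreover have "(Y has_vector_derivative B s *v Y s) (at s)" for s
    by (rule deriv[of s "\<bar>s\<bar> + 1"]) simp
  ultimately show ?thesis
    by blast
qed

section \<open>Uniqueness by Gronwall's inequality\<close>

text \<open>To the right of \<open>s0\<close> the product \<open>E u * exp (- K * u)\<close> is
  nonincreasing; to the left \<open>E u * exp (K * u)\<close> is nondecreasing. Both vanish at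
  \<open>s0\<close>, so \<open>E s \<le> 0\<close> in either case.\<close>

lemma gronwall_zero:
  fixes E :: "real \<Rightarrow> real"
  assumes E: "\<And>r. (E has_real_derivative E' r) (at r)"
    and E': "\<And>r. \<bar>r\<bar> \<le> R \<Longrightarrow> \<bar>E' r\<bar> \<le> K * E r"
    and "E s0 = 0" "0 \<le> E s" "\<bar>s0\<bar> \<le> R" "\<bar>s\<bar> \<le> R"
  shows "E s = 0"
proof -
  have deriv: "((\<lambda>u. E u * exp (c * u)) has_real_derivative (E' r + c * E r) * exp (c * r)) (at r)"
    for c r
    by (auto intro!: derivative_eq_intros E simp: algebra_simps)
  have "E s \<le> 0"
  proof (cases "s0 \<le> s")
    case True
    have "E s * exp (- K * s) \<le> E s0 * exp (- K * s0)"
    proof (rule DERIV_nonpos_imp_nonincreasing[OF True])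
      fix r assume "s0 \<le> r" "r \<le> s"
      then have "\<bar>r\<bar> \<le> R"
        using assms by linarith
      then have "E' r + - K * E r \<le> 0"
        using E'[of r] by simp
      then show "\<exists>y. ((\<lambda>u. E u * exp (- K * u)) has_real_derivative y) (at r) \<and> y \<le> 0"
        using deriv[of "- K" r] by (meson exp_ge_zero mult_nonpos_nonneg)
    qed
    then show ?thesis
      using \<open>E s0 = 0\<close> by (simp add: mult_le_0_iff)
  next
    case False
    then have "s \<le> s0"
      by simp
    have "E s * exp (K * s) \<le> E s0 * exp (K * s0)"
    proof (rule DERIV_nonneg_imp_nondecreasing[OF \<open>s \<le> s0\<close>])
      fix r assume "s \<le> r" "r \<le> s0"
      then have "\<bar>r\<bar> \<le> R"
        using assms by linarith
      then have "0 \<le> E' r + K * E r"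
        using E'[of r] by simp
      then show "\<exists>y. ((\<lambda>u. E u * exp (K * u)) has_real_derivative y) (at r) \<and> 0 \<le> y"
        using deriv[of K r] by (meson exp_ge_zero mult_nonneg_nonneg)
    qed
    then show ?thesis
      using \<open>E s0 = 0\<close> by (simp add: mult_le_0_iff)
  qed
  then show ?thesis
    using assms by simp
qed

text \<open>Gronwall is applied to \<open>y u \<bullet> y u\<close>. Its derivative
  \<open>2 * (y r \<bullet> (B r *v y r))\<close> is at most \<open>2 * M\<close> times the function
  in absolute value, by Cauchy-Schwarz.\<close>

lemma linear_ode_zero:
  fixes B :: "real \<Rightarrow> real^'n^'n"
  assumes B: "continuous_on UNIV B"
    and y: "\<And>s. (y has_vector_derivative B s *v y s) (at s)" and "y s0 = 0"
  shows "y s = 0"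
proof -
  define R where "R = max \<bar>s0\<bar> \<bar>s\<bar>"
  obtain M where M: "0 \<le> M" "\<And>r u. \<bar>r\<bar> \<le> R \<Longrightarrow> norm (B r *v u) \<le> M * norm u"
    using continuous_matrix_locally_bounded[OF B] by blast
  have deriv: "((\<lambda>u. y u \<bullet> y u) has_real_derivative 2 * (y r \<bullet> (B r *v y r))) (at r)" for r
    using bounded_bilinear.has_vector_derivative[OF bounded_bilinear_inner y[of r] y[of r]]
    unfolding has_real_derivative_iff_has_vector_derivative
    by (simp add: inner_commute)
  have "\<bar>2 * (y r \<bullet> (B r *v y r))\<bar> \<le> 2 * M * (y r \<bullet> y r)" if "\<bar>r\<bar> \<le> R" for r
  proof -
    have "\<bar>y r \<bullet> (B r *v y r)\<bar> \<le> norm (y r) * (M * norm (y r))"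
      by (rule order_trans[OF Cauchy_Schwarz_ineq2]) (intro mult_left_mono M that norm_ge_zero)
    also have "\<dots> = M * (y r \<bullet> y r)"
      by (simp add: power2_norm_eq_inner[symmetric] power2_eq_square)
    finally show ?thesis
      by (simp add: abs_mult)
  qed
  then have "y s \<bullet> y s = 0"
    by (rule gronwall_zero[OF deriv, where ?s0.0 = s0]) (auto simp: R_def \<open>y s0 = 0\<close>)
  then show ?thesis
    by simp
qed

section \<open>The conformable time change\<close>

text \<open>A bridge between limits of quotients, as in the conformable derivative, and the
  remainder form behind \<open>has_derivative\<close>: for \<open>h \<noteq> 0\<close> the two norms
  coincide.\<close>

lemma has_vector_derivative_iff_quotient:
  "(f has_vector_derivative v) (at x) \<longleftrightarrow> ((\<lambda>h. (f (x + h) - f x) /\<^sub>R h) \<longlongrightarrow> v) (at 0)"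
proof -
  have "((\<lambda>h. (f (x + h) - f x) /\<^sub>R h) \<longlongrightarrow> v) (at 0) \<longleftrightarrow>
      ((\<lambda>h. norm ((f (x + h) - f x) /\<^sub>R h - v)) \<longlongrightarrow> 0) (at 0)"
    by (simp add: tendsto_norm_zero_iff LIM_zero_iff)
  also have "\<dots> \<longleftrightarrow> ((\<lambda>h. norm (f (x + h) - f x - h *\<^sub>R v) / norm h) \<longlongrightarrow> 0) (at 0)"
  proof (rule filterlim_cong)
    have "norm ((f (x + h) - f x) /\<^sub>R h - v) = norm (f (x + h) - f x - h *\<^sub>R v) / norm h"
      if "h \<noteq> 0" for h
    proof -
      have "(f (x + h) - f x) /\<^sub>R h - v = (f (x + h) - f x - h *\<^sub>R v) /\<^sub>R h"
        using that by (simp add: scaleR_diff_right)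
      then show ?thesis
        by (simp add: divide_inverse mult.commute)
    qed
    then show "\<forall>\<^sub>F h in at 0. norm ((f (x + h) - f x) /\<^sub>R h - v) =
        norm (f (x + h) - f x - h *\<^sub>R v) / norm h"
      by (simp add: eventually_at_filter)
  qed auto
  finally show ?thesis
    by (simp add: has_vector_derivative_def has_derivative_at bounded_linear_scaleR_left)
qed

text \<open>With \<open>c = \<bar>t\<bar> powr (1 - \<alpha>)\<close>, the quotient is the ordinary
  one at 0 of \<open>\<lambda>e. g (t + e * c)\<close>. Since \<open>c > 0\<close>, this affine
  substitution is invertible and the chain rule works both ways; differentiability of
  \<open>g\<close> at \<open>t\<close> is thus a consequence, not an assumption.\<close>

lemma conformable_quotient_limit_iff:
  assumes "t \<noteq> 0"
  shows "conformable_quotient_limit \<alpha> g v t \<longleftrightarrow>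
    (g has_vector_derivative \<bar>t\<bar> powr (\<alpha> - 1) *\<^sub>R v) (at t)"
proof -
  define c where "c = \<bar>t\<bar> powr (1 - \<alpha>)"
  have "0 < c" and c': "\<bar>t\<bar> powr (\<alpha> - 1) = inverse c"
    using assms powr_minus[of "\<bar>t\<bar>" "1 - \<alpha>"] by (simp_all add: c_def)
  have "conformable_quotient_limit \<alpha> g v t \<longleftrightarrow>
      ((\<lambda>e. g (t + e * c)) has_vector_derivative v) (at 0)"
    by (simp add: conformable_quotient_limit_def has_vector_derivative_iff_quotient c_def)
  also have "\<dots> \<longleftrightarrow> (g has_vector_derivative inverse c *\<^sub>R v) (at t)"
  proof
    assume *: "((\<lambda>e. g (t + e * c)) has_vector_derivative v) (at 0)"
    have "((\<lambda>u. (u - t) / c) has_vector_derivative inverse c) (at t)"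
      unfolding has_real_derivative_iff_has_vector_derivative[symmetric]
      using \<open>0 < c\<close> by (auto intro!: derivative_eq_intros simp: field_simps)
    from vector_diff_chain_at[OF this, of "\<lambda>e. g (t + e * c)" v] *
    show "(g has_vector_derivative inverse c *\<^sub>R v) (at t)"
      using \<open>0 < c\<close> by (simp add: o_def)
  next
    assume *: "(g has_vector_derivative inverse c *\<^sub>R v) (at t)"
    have "((\<lambda>e. t + e * c) has_vector_derivative c) (at 0)"
      unfolding has_real_derivative_iff_has_vector_derivative[symmetric]
      by (auto intro!: derivative_eq_intros)
    from vector_diff_chain_at[OF this, of g "inverse c *\<^sub>R v"] *
    show "((\<lambda>e. g (t + e * c)) has_vector_derivative v) (at 0)"
      using \<open>0 < c\<close> by (simp add: o_def)
  qed
  finally show ?thesis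
    by (simp add: c')
qed

section \<open>Signed powers and the time change\<close>

text \<open>The odd extension of the power function to the whole line. Reciprocal exponents give
  mutually inverse maps, so up to scaling the time change and its inverse both have this
  form.\<close>

definition signed_powr :: "real \<Rightarrow> real \<Rightarrow> real" where
  "signed_powr p t = sgn t * \<bar>t\<bar> powr p"

lemma signed_powr_0 [simp]: "signed_powr p 0 = 0"
  by (simp add: signed_powr_def)

lemma signed_powr_eq_0_iff [simp]: "signed_powr p t = 0 \<longleftrightarrow> t = 0"
  by (auto simp: signed_powr_def sgn_zero_iff)

lemma abs_signed_powr [simp]: "\<bar>signed_powr p t\<bar> = \<bar>t\<bar> powr p"
  by (cases "t = 0") (simp_all add: signed_powr_def abs_mult abs_sgn_eq)

lemma signed_powr_signed_powr:
  assumes "p * q = 1"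
  shows "signed_powr p (signed_powr q t) = t"
proof (cases "t = 0")
  case False
  then have "sgn (signed_powr q t) = sgn t"
    by (simp add: signed_powr_def sgn_mult)
  moreover have "(\<bar>t\<bar> powr q) powr p = \<bar>t\<bar>"
    using assms by (simp add: powr_powr mult.commute)
  ultimately show ?thesis
    unfolding signed_powr_def[of p] abs_signed_powr by (simp add: sgn_mult_abs)
qed simp

lemma has_real_derivative_signed_powr:
  assumes "t \<noteq> 0"
  shows "(signed_powr p has_real_derivative p * \<bar>t\<bar> powr (p - 1)) (at t)"
proof (cases "0 < t")
  case True
  have "((\<lambda>u. u powr p) has_real_derivative p * \<bar>t\<bar> powr (p - 1)) (at t)"
    using True by (auto intro!: derivative_eq_intros simp: field_simps powr_diff)
  then show ?thesis
    by (rule has_field_derivative_transform_within_open[where S = "{0<..}"])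
      (use True in \<open>auto simp: signed_powr_def\<close>)
next
  case False
  then have "t < 0"
    using assms by simp
  have "((\<lambda>u. - ((- u) powr p)) has_real_derivative p * \<bar>t\<bar> powr (p - 1)) (at t)"
    using \<open>t < 0\<close> by (auto intro!: derivative_eq_intros simp: field_simps powr_diff)
  then show ?thesis
    by (rule has_field_derivative_transform_within_open[where S = "{..<0}"])
      (use \<open>t < 0\<close> in \<open>auto simp: signed_powr_def\<close>)
qed

text \<open>Off 0 the function is differentiable; at 0 its absolute value
  \<open>\<bar>u\<bar> powr p\<close> tends to 0 because \<open>p\<close> is positive.\<close>

lemma continuous_on_signed_powr:
  assumes "0 < p"
  shows "continuous_on UNIV (signed_powr p)"
proof -
  have "isCont (signed_powr p) t" for t
  proof (cases "t = 0")
    case True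
    have "((\<lambda>u::real. \<bar>u\<bar> powr p) \<longlongrightarrow> \<bar>0\<bar> powr p) (at 0)"
      using assms by (intro tendsto_powr' tendsto_intros) auto
    then have "(signed_powr p \<longlongrightarrow> 0) (at 0)"
      by (subst tendsto_rabs_zero_iff[symmetric]) simp
    then show ?thesis
      using True by (simp add: isCont_def)
  qed (use has_real_derivative_signed_powr DERIV_isCont in blast)
  then show ?thesis
    by (simp add: continuous_on_eq_continuous_at)
qed

text \<open>Subtracting an antiderivative \<open>F\<close> of \<open>f\<close> leaves a continuous
  function with zero derivative off \<open>c\<close>, hence a constant; so \<open>y\<close> inherits
  the derivative of \<open>F\<close> at \<open>c\<close> too.\<close>

lemma has_vector_derivative_removable:
  fixes y :: "real \<Rightarrow> 'a::euclidean_space"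
  assumes y: "continuous_on UNIV y" and f: "continuous_on UNIV f"
    and deriv: "\<And>s. s \<noteq> c \<Longrightarrow> (y has_vector_derivative f s) (at s)"
  shows "(y has_vector_derivative f s) (at s)"
proof -
  obtain F where F: "\<And>s. (F has_vector_derivative f s) (at s)"
    using ex_antiderivative[OF f] by blast
  have "y u - F u = y 0 - F 0" for u
  proof (rule has_derivative_zero_unique_strong_connected[where S = UNIV and K = "{c}"])
    show "continuous_on UNIV (\<lambda>u. y u - F u)"
      by (intro continuous_on_diff y has_vector_derivative_imp_continuous_on[OF F])
    show "((\<lambda>u. y u - F u) has_derivative (\<lambda>h. 0)) (at r)" if "r \<in> UNIV - {c}" for r
      using has_vector_derivative_diff[OF deriv F[of r]] that
      by (simp add: has_vector_derivative_def)
  qed auto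
  then have "y = (\<lambda>u. F u + (y 0 - F 0))"
    by (auto simp: algebra_simps)
  moreover have "((\<lambda>u. F u + (y 0 - F 0)) has_vector_derivative f s) (at s)"
    using F by (simp add: has_vector_derivative_add_const)
  ultimately show ?thesis
    by simp
qed

text \<open>Inverse of the time change \<open>t \<mapsto> sgn t * \<bar>t\<bar> powr \<alpha> / \<alpha>\<close>, whose derivative is
  \<open>\<bar>t\<bar> powr (\<alpha> - 1)\<close>.\<close>

definition conformable_time :: "real \<Rightarrow> real \<Rightarrow> real" where
  "conformable_time \<alpha> s = signed_powr (1 / \<alpha>) (\<alpha> * s)"

lemma conformable_time_signed_powr [simp]:
  "0 < \<alpha> \<Longrightarrow> conformable_time \<alpha> (signed_powr \<alpha> t / \<alpha>) = t"
  by (simp add: conformable_time_def signed_powr_signed_powr)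

lemma continuous_on_conformable_time:
  assumes "0 < \<alpha>"
  shows "continuous_on UNIV (conformable_time \<alpha>)"
  unfolding conformable_time_def
  by (rule continuous_on_compose2[OF continuous_on_signed_powr])
    (use assms in \<open>auto intro!: continuous_intros\<close>)

text \<open>Writing the derivative in terms of the value of the function makes it cancel the factor
  \<open>\<bar>t\<bar> powr (\<alpha> - 1)\<close> of the conformable equation at
  \<open>t = conformable_time \<alpha> s\<close>.\<close>

lemma has_vector_derivative_conformable_time:
  assumes "0 < \<alpha>" "s \<noteq> 0"
  shows "(conformable_time \<alpha> has_vector_derivative \<bar>conformable_time \<alpha> s\<bar> powr (1 - \<alpha>)) (at s)"
proof -
  have "((\<lambda>s. \<alpha> * s) has_real_derivative \<alpha>) (at s)"
    by (auto intro!: derivative_eq_intros)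
  from DERIV_chain2[OF has_real_derivative_signed_powr this, of "1 / \<alpha>"]
  have "(conformable_time \<alpha> has_real_derivative \<bar>\<alpha> * s\<bar> powr (1 / \<alpha> - 1)) (at s)"
    using assms by (simp add: conformable_time_def[abs_def])
  also have "\<bar>\<alpha> * s\<bar> powr (1 / \<alpha> - 1) = \<bar>conformable_time \<alpha> s\<bar> powr (1 - \<alpha>)"
    using assms by (simp add: conformable_time_def powr_powr field_simps)
  finally show ?thesis
    by (simp add: has_real_derivative_iff_has_vector_derivative)
qed

text \<open>Off 0 the chain rule translates one equation into the other. At 0 the linear system
  follows by \<open>has_vector_derivative_removable\<close>, and the conformable equation by
  continuity of \<open>A t *v x t\<close>.\<close>

lemma conformable_solution_iff:
  fixes A :: "real \<Rightarrow> real^'n^'n"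
  assumes \<alpha>: "0 < \<alpha>" and A: "continuous_on UNIV A"
  defines "\<psi> \<equiv> conformable_time \<alpha>"
  shows "conformable_solution \<alpha> A x \<longleftrightarrow>
    (\<forall>s. ((\<lambda>u. x (\<psi> u)) has_vector_derivative A (\<psi> s) *v x (\<psi> s)) (at s))"
proof
  have \<psi>: "continuous_on UNIV \<psi>"
    unfolding \<psi>_def by (rule continuous_on_conformable_time[OF \<alpha>])
  have \<psi>_0: "\<psi> s = 0 \<longleftrightarrow> s = 0" for s
    using \<alpha> by (simp add: \<psi>_def conformable_time_def)
  {
    assume x: "conformable_solution \<alpha> A x"
    then have x_cont: "continuous_on UNIV x"
      by (simp add: conformable_solution_def)
    have "((\<lambda>u. x (\<psi> u)) has_vector_derivative A (\<psi> s) *v x (\<psi> s)) (at s)" if "s \<noteq> 0" for s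
    proof -
      have "(x has_vector_derivative \<bar>\<psi> s\<bar> powr (\<alpha> - 1) *\<^sub>R (A (\<psi> s) *v x (\<psi> s))) (at (\<psi> s))"
      proof -
        have "has_conformable_derivative \<alpha> x (A (\<psi> s) *v x (\<psi> s)) (\<psi> s)"
          using x by (simp add: conformable_solution_def)
        then show ?thesis
          using that \<psi>_0 by (simp add: has_conformable_derivative_def conformable_quotient_limit_iff)
      qed
      \<comment> \<open>The exponents \<open>\<alpha> - 1\<close> and \<open>1 - \<alpha>\<close>
        add up to 0, and the base is nonzero.\<close>
      from vector_diff_chain_at[OF
          has_vector_derivative_conformable_time[OF \<alpha> that, folded \<psi>_def] this]
      show ?thesis
        using that \<psi>_0 by (simp add: o_def powr_add[symmetric])
    qed
    moreover have x\<psi>: "continuous_on UNIV (\<lambda>u. x (\<psi> u))"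
      by (rule continuous_on_compose2[OF x_cont \<psi>]) simp
    moreover have "continuous_on UNIV (\<lambda>u. A (\<psi> u) *v x (\<psi> u))"
      by (rule continuous_on_matrix_vector_mult[OF continuous_on_compose2[OF A \<psi>] x\<psi>]) simp
    ultimately show "\<forall>s. ((\<lambda>u. x (\<psi> u)) has_vector_derivative A (\<psi> s) *v x (\<psi> s)) (at s)"
      using has_vector_derivative_removable[where c = 0] by blast
  next
    assume y: "\<forall>s. ((\<lambda>u. x (\<psi> u)) has_vector_derivative A (\<psi> s) *v x (\<psi> s)) (at s)"
    \<comment> \<open>The time change itself; \<open>\<psi> (\<phi> t) = t\<close> recovers
      \<open>x\<close> from its composition with \<open>\<psi>\<close>.\<close>
    define \<phi> where "\<phi> t = signed_powr \<alpha> t / \<alpha>" for t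
    have \<psi>\<phi>: "\<psi> (\<phi> t) = t" for t
      using \<alpha> by (simp add: \<psi>_def \<phi>_def)
    have "continuous_on UNIV (\<lambda>u. x (\<psi> u))"
      by (rule has_vector_derivative_imp_continuous_on[OF y[rule_format]])
    moreover have "continuous_on UNIV \<phi>"
      unfolding \<phi>_def using \<alpha> by (auto intro!: continuous_intros continuous_on_signed_powr)
    ultimately have "continuous_on UNIV (\<lambda>t. x (\<psi> (\<phi> t)))"
      by (auto intro: continuous_on_compose2)
    then have x_cont: "continuous_on UNIV x"
      by (simp add: \<psi>\<phi>)
    have lim: "conformable_quotient_limit \<alpha> x (A t *v x t) t" if "t \<noteq> 0" for t
    proof -
      have "(\<phi> has_vector_derivative \<bar>t\<bar> powr (\<alpha> - 1)) (at t)"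
        unfolding has_real_derivative_iff_has_vector_derivative[symmetric] \<phi>_def
        using \<alpha> that by (auto intro!: derivative_eq_intros has_real_derivative_signed_powr)
      from vector_diff_chain_at[OF this y[rule_format]]
      show ?thesis
        using that by (simp add: conformable_quotient_limit_iff o_def \<psi>\<phi>)
    qed
    \<comment> \<open>The witness for the derivatives near 0 is
      \<open>\<lambda>t. A t *v x t\<close>, which has the required limit by continuity.\<close>
    have "continuous_on UNIV (\<lambda>t. A t *v x t)"
      by (intro continuous_on_matrix_vector_mult A x_cont)
    then have "((\<lambda>t. A t *v x t) \<longlongrightarrow> A 0 *v x 0) (at 0)"
      by (simp add: continuous_on_def)
    moreover have "\<forall>\<^sub>F s in at 0. conformable_quotient_limit \<alpha> x (A s *v x s) s"
      using lim by (simp add: eventually_at_filter)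
    ultimately have "has_conformable_derivative \<alpha> x (A t *v x t) t" for t
      using lim by (auto simp: has_conformable_derivative_def)
    then show "conformable_solution \<alpha> A x"
      by (simp add: conformable_solution_def x_cont)
  }
qed

section \<open>Existence, uniqueness and linearity for the conformable equation\<close>

lemma conformable_solution_existence:
  fixes A :: "real \<Rightarrow> real^'n^'n"
  assumes \<alpha>: "0 < \<alpha>" and A: "continuous_on UNIV A"
  shows "\<exists>x. conformable_solution \<alpha> A x \<and> x 0 = v"
proof -
  have "continuous_on UNIV (\<lambda>s. A (conformable_time \<alpha> s))"
    by (rule continuous_on_compose2[OF A continuous_on_conformable_time[OF \<alpha>]]) auto
  from linear_ode_existence[OF this, of v] obtain y where "y 0 = v"
    and y: "\<And>s. (y has_vector_derivative A (conformable_time \<alpha> s) *v y s) (at s)"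
    by blast
  define x where "x t = y (signed_powr \<alpha> t / \<alpha>)" for t
  have "x (conformable_time \<alpha> s) = y s" for s
    using \<alpha> by (simp add: x_def conformable_time_def signed_powr_signed_powr)
  then have "conformable_solution \<alpha> A x"
    using y by (simp add: conformable_solution_iff[OF \<alpha> A])
  moreover have "x 0 = v"
    by (simp add: x_def \<open>y 0 = v\<close>)
  ultimately show ?thesis
    by blast
qed

lemma conformable_solution_zero:
  fixes A :: "real \<Rightarrow> real^'n^'n"
  assumes \<alpha>: "0 < \<alpha>" and A: "continuous_on UNIV A"
    and x: "conformable_solution \<alpha> A x" and "x t0 = 0"
  shows "x t = 0"
proof -
  have "continuous_on UNIV (\<lambda>s. A (conformable_time \<alpha> s))"
    by (rule continuous_on_compose2[OF A continuous_on_conformable_time[OF \<alpha>]]) auto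
  from linear_ode_zero[OF this x[unfolded conformable_solution_iff[OF \<alpha> A], rule_format],
      of "signed_powr \<alpha> t0 / \<alpha>" "signed_powr \<alpha> t / \<alpha>"]
  show ?thesis
    using \<alpha> \<open>x t0 = 0\<close> by simp
qed

text \<open>Linearity is read off the linear system, so that no limits at \<open>t = 0\<close> have
  to be combined.\<close>

lemma conformable_solution_diff:
  fixes A :: "real \<Rightarrow> real^'n^'n"
  assumes "0 < \<alpha>" "continuous_on UNIV A"
    and "conformable_solution \<alpha> A x" "conformable_solution \<alpha> A y"
  shows "conformable_solution \<alpha> A (\<lambda>t. x t - y t)"
  using assms
  by (simp add: conformable_solution_iff matrix_vector_mult_diff_distrib has_vector_derivative_diff)

section \<open>Fundamental solutions\<close>

text \<open>Superposition: \<open>X t *v c\<close> is the combination of the columns of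
  \<open>X t\<close> with the entries of \<open>c\<close> as coefficients.\<close>

lemma conformable_solution_fundamental:
  fixes A :: "real \<Rightarrow> real^'n^'n"
  assumes \<alpha>: "0 < \<alpha>" and A: "continuous_on UNIV A" and X: "fundamental_solution \<alpha> A X"
  shows "conformable_solution \<alpha> A (\<lambda>t. X t *v c)"
proof -
  let ?\<psi> = "conformable_time \<alpha>"
  have "((\<lambda>u. column j (X (?\<psi> u))) has_vector_derivative A (?\<psi> s) *v column j (X (?\<psi> s))) (at s)"
    for j s
    using X by (simp add: fundamental_solution_def conformable_solution_iff[OF \<alpha> A])
  then have "((\<lambda>u. \<Sum>j\<in>UNIV. c $ j *\<^sub>R column j (X (?\<psi> u))) has_vector_derivative
      (\<Sum>j\<in>UNIV. c $ j *\<^sub>R (A (?\<psi> s) *v column j (X (?\<psi> s))))) (at s)" for s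
    by (intro has_vector_derivative_sum
        bounded_linear.has_vector_derivative[OF bounded_linear_scaleR_right])
  then show ?thesis
    unfolding conformable_solution_iff[OF \<alpha> A] matrix_mult_sum[of "X _"] scalar_mult_eq_scaleR
    by (simp add: linear_sum[OF matrix_vector_mul_linear] matrix_vector_mult_scaleR)
qed

lemma fundamental_solution_invertible:
  fixes A :: "real \<Rightarrow> real^'n^'n"
  assumes \<alpha>: "0 < \<alpha>" and A: "continuous_on UNIV A" and X: "fundamental_solution \<alpha> A X"
  shows "invertible (X t0)"
proof -
  have "c = 0" if "X t0 *v c = 0" for c
  proof -
    have "X t *v c = 0" for t
      by (rule conformable_solution_zero[OF \<alpha> A conformable_solution_fundamental[OF \<alpha> A X]])
        (rule that)
    \<comment> \<open>The kernel vector at \<open>t0\<close> has become a linear relation between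
      the columns as functions.\<close>
    then have "\<forall>t. (\<Sum>j\<in>UNIV. c $ j *\<^sub>R column j (X t)) = 0"
      by (simp add: matrix_mult_sum scalar_mult_eq_scaleR)
    then show ?thesis
      using X by (simp add: fundamental_solution_def vec_eq_iff)
  qed
  then show ?thesis
    by (simp add: invertible_left_inverse matrix_left_invertible_ker)
qed

text \<open>The columns are the solutions starting from the standard basis at time 0; a linear
  relation between them, evaluated there, has zero coefficients.\<close>

lemma ex_fundamental_solution:
  fixes A :: "real \<Rightarrow> real^'n^'n"
  assumes \<alpha>: "0 < \<alpha>" and A: "continuous_on UNIV A"
  shows "\<exists>X. fundamental_solution \<alpha> A X"
proof -
  have "\<forall>j. \<exists>x. conformable_solution \<alpha> A x \<and> x 0 = axis j 1"
    using conformable_solution_existence[OF \<alpha> A] by blast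
  then obtain x :: "'n \<Rightarrow> real \<Rightarrow> real^'n"
    where x: "\<And>j. conformable_solution \<alpha> A (x j)" "\<And>j. x j 0 = axis j 1"
    by metis
  define X where "X t = (\<chi> i j. x j t $ i)" for t
  have column: "column j (X t) = x j t" for j t
    by (simp add: X_def column_def vec_eq_iff)
  have "c j = 0" if "\<forall>t. (\<Sum>j\<in>UNIV. c j *\<^sub>R x j t) = 0" for c j
  proof -
    have "(\<Sum>j\<in>UNIV. c j *\<^sub>R (axis j 1 :: real^'n)) = 0"
      using that[rule_format, of 0] by (simp add: x(2))
    then have "(\<Sum>k\<in>UNIV. c k *\<^sub>R (axis k 1 :: real^'n)) $ j = 0"
      by simp
    then show ?thesis
      by (simp add: axis_def if_distrib cong: if_cong)
  qed
  then show ?thesis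
    using x(1) by (intro exI[of _ X]) (simp add: fundamental_solution_def column)
qed

text \<open>The first conjunct keeps the quantifier over \<open>X\<close> from being vacuous, and
  invertibility makes \<open>matrix_inv (X t0)\<close> an actual inverse. Uniqueness holds because
  the difference of two solutions with the same data vanishes at \<open>t0\<close>.\<close>

theorem proposition2p6:
  fixes \<alpha> t0 :: real and A :: "real \<Rightarrow> real^'n^'n" and x0 :: "real^'n"
  assumes "0 < \<alpha>" and "\<alpha> \<le> 1" and "continuous_on UNIV A"
  shows "(\<exists>X. fundamental_solution \<alpha> A X) \<and>
    (\<forall>X. fundamental_solution \<alpha> A X \<longrightarrow>
       invertible (X t0) \<and>
       (\<forall>x. conformable_solution \<alpha> A x \<and> x t0 = x0 \<longleftrightarrow>
            (\<forall>t. x t = (X t ** matrix_inv (X t0)) *v x0)))"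
proof (intro conjI allI impI)
  show "\<exists>X. fundamental_solution \<alpha> A X"
    using assms by (rule_tac ex_fundamental_solution)
next
  fix X
  assume X: "fundamental_solution \<alpha> A X"
  show inv: "invertible (X t0)"
    using fundamental_solution_invertible[OF assms(1,3) X] .
  let ?z = "\<lambda>t. (X t ** matrix_inv (X t0)) *v x0"
  have z: "conformable_solution \<alpha> A ?z"
    using conformable_solution_fundamental[OF assms(1,3) X, of "matrix_inv (X t0) *v x0"]
    by (simp add: matrix_vector_mul_assoc)
  \<comment> \<open>\<open>matrix_inv\<close> is a choice; invertibility provides the witness that
    makes it an inverse.\<close>
  have "X t0 ** matrix_inv (X t0) = mat 1"
    using someI_ex[OF inv[unfolded invertible_def]] by (simp add: matrix_inv_def)
  then have z0: "?z t0 = x0"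
    by simp
  fix x
  show "conformable_solution \<alpha> A x \<and> x t0 = x0 \<longleftrightarrow> (\<forall>t. x t = ?z t)"
  proof
    assume x: "conformable_solution \<alpha> A x \<and> x t0 = x0"
    then have "conformable_solution \<alpha> A (\<lambda>t. x t - ?z t)"
      using conformable_solution_diff[OF assms(1,3) _ z] by blast
    from conformable_solution_zero[OF assms(1,3) this, of t0] show "\<forall>t. x t = ?z t"
      using x z0 by simp
  next
    assume "\<forall>t. x t = ?z t"
    then have "x = ?z"
      by auto
    then show "conformable_solution \<alpha> A x \<and> x t0 = x0"
      using z z0 by blast
  qed
qed

end
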